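(* Let $d\ge1$, let $f$ be a uniformly continuous probability density on $\mathbb{R}^d$, and let $r>0$. Then the functions $x\mapsto\mathrm{H}_r^kf_r(x)$ converge uniformly in $x\in\mathbb{R}^d$ as $k\to\infty$.
   Context: $\mathsf{B}(x,r)$ is the closed Euclidean ball of center $x$ and radius $r$, and $\omega$ is the volume of the unit ball of $\mathbb{R}^d$. For a non-negative bounded measurable $\phi:\mathbb{R}^d\to\mathbb{R}$, $$\mathrm{H}_r\phi(x)=\sup\Big\{t\ge0 : \frac1{\omega r^d}\int_{\mathsf{B}(x,r)}\mathbf{1}_{\phi(z)\ge t}\,f(z)\,dz\ge t\Big\},$$ $\mathrm{H}_r^k$ is its $k$-th iterate, and $f_r(x)=\frac{1}{\omega r^d}\int_{\mathsf{B}(x,r)}f(z)\,dz$. (The limit is called the continuum $r$-coreness and denoted $\mathrm{C}_r(x,f)$.) *)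

theory Defs
  imports "HOL-Analysis.Analysis"
begin

definition prob_density :: "(real ^ 'd \<Rightarrow> real) \<Rightarrow> bool" where
  "prob_density f \<longleftrightarrow>
     f \<in> borel_measurable borel \<and> (\<forall>x. 0 \<le> f x) \<and>
     integrable lborel f \<and> (\<integral>x. f x \<partial>lborel) = 1"

definition unit_ball_volume :: "'d::finite itself \<Rightarrow> real" where
  "unit_ball_volume _ = measure lborel (cball (0 :: real ^ 'd) 1)"

definition ball_avg :: "real \<Rightarrow> (real ^ 'd \<Rightarrow> real) \<Rightarrow> real ^ 'd \<Rightarrow> real" where
  "ball_avg r f x =
     1 / (unit_ball_volume TYPE('d) * r ^ CARD('d)) * (LINT z:cball x r|lborel. f z)"

text \<open>
  The operator \<open>H\<^sub>r\<close>, with its dependence on the density \<open>f\<close> made explicit. It is only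
  meaningful for non-negative, bounded, measurable \<open>\<phi>\<close>. For \<open>f \<ge> 0\<close> locally integrable and
  \<open>r > 0\<close>, the set below contains \<open>0\<close> and is bounded above by \<open>ball_avg r f x\<close>, so that
  \<open>Sup\<close> on the reals is a genuine supremum.
\<close>

definition H_op :: "real \<Rightarrow> (real ^ 'd \<Rightarrow> real) \<Rightarrow> (real ^ 'd \<Rightarrow> real) \<Rightarrow> real ^ 'd \<Rightarrow> real" where
  "H_op r f \<phi> x =
     Sup {t. 0 \<le> t \<and>
       1 / (unit_ball_volume TYPE('d) * r ^ CARD('d)) *
         (LINT z:cball x r|lborel. indicator {z. \<phi> z \<ge> t} z * f z) \<ge> t}"

end

theory Submission
  imports Defs
begin

text \<open>
  Write \<open>\<phi>\<^sub>k = H\<^sub>r\<^sup>k f\<^sub>r\<close>. The operator \<open>H\<^sub>r\<close> is monotone and bounded by \<open>f\<^sub>r\<close>, so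
  \<open>\<phi>\<^sub>1 \<le> \<phi>\<^sub>0\<close>, hence \<open>\<phi>\<^sub>k\<close> decreases in \<open>k\<close>; being non-negative, it
  converges pointwise.

  Two facts make the convergence uniform. The first is equicontinuity: if translating the
  argument by \<open>h\<close> raises neither \<open>f\<close> nor \<open>\<phi>\<close> by more than \<open>\<eta>\<close>, then it does not raise
  \<open>H\<^sub>r \<phi>\<close> by more than \<open>\<eta>\<close> either (\<open>H_op_shift_le\<close>). As the same holds for \<open>f\<^sub>r\<close>, all the
  \<open>\<phi>\<^sub>k\<close> have the modulus of continuity of \<open>f\<close>. The second is that
  \<open>0 \<le> \<phi>\<^sub>k \<le> f\<^sub>r\<close>, where \<open>f\<^sub>r\<close> vanishes at infinity because \<open>f\<close> is integrable
  (\<open>ball_avg_vanishes_at_infinity\<close>); this gives uniform smallness outside a compact set.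
  An equicontinuous, pointwise convergent sequence converges uniformly on that compact set.
\<close>

section \<open>Averages over balls\<close>

text \<open>
  Lebesgue measure is translation invariant and the average of a constant is that constant.
  Taking \<open>h = 0\<close> and \<open>\<eta> = 0\<close> gives monotonicity of the average.
\<close>
lemma ball_avg_shift_le:
  fixes u v :: "real ^ 'd \<Rightarrow> real"
  assumes u: "integrable lborel u" and v: "integrable lborel v" and "r > 0"
    and le: "\<And>z. u (h + z) \<le> v z + \<eta>"
  shows "ball_avg r u (h + x) \<le> ball_avg r v x + \<eta>"
proof -
  let ?w = "unit_ball_volume TYPE('d) * r ^ CARD('d)"
  have vol: "measure lborel (cball x r) = ?w" and pos: "?w > 0"
    using content_cball[of r x] content_cball[of 1 "0 :: real ^ 'd"] \<open>r > 0\<close>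
    by (simp_all add: unit_ball_volume_def)
  have int_h: "integrable lborel (\<lambda>z. u (h + z))"
    using u integrable_distr_eq[of "(+) h" lborel borel u]
    by (simp add: lborel_distr_plus)
  have int_ind: "set_integrable lborel (cball x r) g" if "integrable lborel g" for g :: "real ^ 'd \<Rightarrow> real"
    using integrable_mult_indicator[OF _ that] by (simp add: set_integrable_def)
  have int_c: "set_integrable lborel (cball x r) (\<lambda>z. \<eta>)"
    using emeasure_lborel_cball_finite[of x r]
    by (simp add: set_integrable_def integrable_real_indicator)
  have "(LINT z:cball (h + x) r|lborel. u z)
      = (LINT z|distr lborel borel ((+) h). indicator (cball (h + x) r) z *\<^sub>R u z)"
    by (simp add: set_lebesgue_integral_def lborel_distr_plus)
  also have "\<dots> = (LINT z|lborel. indicator (cball (h + x) r) (h + z) *\<^sub>R u (h + z))"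
    using borel_measurable_integrable[OF u] by (intro integral_distr borel_measurable_scaleR borel_measurable_indicator) auto
  also have "\<dots> = (LINT z:cball x r|lborel. u (h + z))"
    unfolding set_lebesgue_integral_def
    by (intro Bochner_Integration.integral_cong) (auto simp: indicator_def dist_norm)
  also have "\<dots> \<le> (LINT z:cball x r|lborel. v z + \<eta>)"
    using le by (intro set_integral_mono set_integral_add(1) int_ind int_h v int_c)
  also have "\<dots> = (LINT z:cball x r|lborel. v z) + \<eta> * ?w"
    using set_integral_add(2)[OF int_ind[OF v] int_c] vol
    by (simp add: set_lebesgue_integral_def mult.commute)
  finally have le_integral: "(LINT z:cball (h + x) r|lborel. u z)
      \<le> (LINT z:cball x r|lborel. v z) + \<eta> * ?w" .
  have "1 / w * a \<le> 1 / w * b + \<eta>" if "a \<le> b + \<eta> * w" "w > 0" for a b w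
    using that by (simp add: field_simps)
  from this[OF le_integral pos] show ?thesis
    by (simp only: ball_avg_def)
qed

lemma ball_avg_nonneg:
  assumes "r > 0" "\<And>z. 0 \<le> f z"
  shows "0 \<le> ball_avg r f x"
  using assms unfolding ball_avg_def unit_ball_volume_def set_lebesgue_integral_def
  by (intro mult_nonneg_nonneg integral_nonneg_AE) auto

text \<open>
  A ball far from the origin lies in the complement of a large ball, which carries little
  of the mass of \<open>f\<close>.
\<close>
lemma ball_avg_vanishes_at_infinity:
  fixes f :: "real ^ 'd \<Rightarrow> real"
  assumes f: "integrable lborel f" and nonneg: "\<And>z. 0 \<le> f z" and "r > 0" "e > 0"
  obtains R where "\<And>x. norm x > R \<Longrightarrow> ball_avg r f x < e"
proof -
  let ?w = "unit_ball_volume TYPE('d) * r ^ CARD('d)"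
  have w: "?w > 0"
    using content_cball[of 1 "0 :: real ^ 'd"] \<open>r > 0\<close> by (simp add: unit_ball_volume_def)
  have "(\<lambda>n::nat. LINT z|lborel. indicator (- cball 0 (real n)) z * f z) \<longlonglongrightarrow> (LINT z|(lborel :: (real^'d) measure). 0)"
  proof (rule integral_dominated_convergence[where w=f])
    show "AE z in lborel. (\<lambda>n. indicator (- cball 0 (real n)) z * f z) \<longlonglongrightarrow> 0"
    proof (rule AE_I2)
      fix z :: "real ^ 'd"
      have "eventually (\<lambda>n. indicator (- cball 0 (real n)) z * f z = 0) sequentially"
        using eventually_ge_at_top[of "nat \<lceil>norm z\<rceil>"]
        by eventually_elim (auto simp: indicator_def nat_ceiling_le_eq)
      then show "(\<lambda>n. indicator (- cball 0 (real n)) z * f z) \<longlonglongrightarrow> 0"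
        by (rule tendsto_eventually)
    qed
  qed (use f nonneg in \<open>auto simp: indicator_def\<close>)
  then have "eventually (\<lambda>n::nat. (LINT z|lborel. indicator (- cball 0 (real n)) z * f z) < e * ?w) sequentially"
    using \<open>e > 0\<close> w by (intro order_tendstoD(2)) auto
  then obtain n :: nat where n: "(LINT z|lborel. indicator (- cball 0 (real n)) z * f z) < e * ?w"
    by (auto simp: eventually_sequentially)
  have "ball_avg r f x < e" if "norm x > real n + r" for x
  proof -
    have far: "norm z > real n" if "z \<in> cball x r" for z
      using that \<open>norm x > real n + r\<close> norm_triangle_sub[of x z] by (auto simp: dist_norm)
    have int: "integrable lborel (\<lambda>z. indicator A z * f z)" if "A \<in> sets borel" for A
      using integrable_mult_indicator[OF _ f, of A] that by simp
    have "(LINT z:cball x r|lborel. f z) \<le> (LINT z|lborel. indicator (- cball 0 (real n)) z * f z)"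
      unfolding set_lebesgue_integral_def real_scaleR_def
    proof (intro integral_mono int)
      fix z
      show "indicator (cball x r) z * f z \<le> indicator (- cball 0 (real n)) z * f z"
        using far[of z] nonneg[of z] by (auto simp: indicator_def)
    qed auto
    with n w show ?thesis
      by (simp add: ball_avg_def field_simps)
  qed
  then show thesis ..
qed

section \<open>Translation bounds and the operator H\<close>

text \<open>
  The bounds are one-sided because this is the form that passes through a supremum; the
  two-sided modulus of continuity comes back by using \<open>h\<close> and \<open>-h\<close>. Quantifying over
  all \<open>h\<close> and \<open>\<eta>\<close> keeps any fixed modulus out of the induction on the iterates.
\<close>
definition inherits_shift_bounds :: "('a::ab_group_add \<Rightarrow> real) \<Rightarrow> ('a \<Rightarrow> real) \<Rightarrow> bool" where
  "inherits_shift_bounds f \<phi> \<longleftrightarrow>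
     (\<forall>h. \<forall>\<eta>\<ge>0. (\<forall>z. f (h + z) \<le> f z + \<eta>) \<longrightarrow> (\<forall>z. \<phi> (h + z) \<le> \<phi> z + \<eta>))"

context
  fixes f :: "real ^ 'd \<Rightarrow> real" and r :: real
  assumes f: "integrable lborel f" and nonneg: "\<And>z. 0 \<le> f z" and r: "r > 0"
begin

lemma integrable_superlevel:
  fixes \<phi> :: "real ^ 'd \<Rightarrow> real"
  assumes "\<phi> \<in> borel_measurable borel"
  shows "integrable lborel (\<lambda>z. indicator {z. \<phi> z \<ge> t} z * f z)"
proof -
  have "{z. \<phi> z \<ge> t} \<in> sets lborel"
    using assms by measurable
  from integrable_mult_indicator[OF this f] show ?thesis by simp
qed

text \<open>
  The weighted measure of a superlevel set is itself a ball average, of \<open>f\<close> cut off to that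
  set, so the lemmas on averages apply to it.
\<close>
lemma H_op_alt:
  fixes \<phi> :: "real ^ 'd \<Rightarrow> real"
  shows "H_op r f \<phi> x = Sup {t. 0 \<le> t \<and> t \<le> ball_avg r (\<lambda>z. indicator {z. \<phi> z \<ge> t} z * f z) x}"
  by (simp add: H_op_def ball_avg_def)

lemma superlevel_avg_le:
  fixes \<phi> :: "real ^ 'd \<Rightarrow> real"
  assumes "\<phi> \<in> borel_measurable borel"
  shows "ball_avg r (\<lambda>z. indicator {z. \<phi> z \<ge> t} z * f z) x \<le> ball_avg r f x"
  using ball_avg_shift_le[OF integrable_superlevel[OF assms] f r, where h = 0 and \<eta> = 0 and x = x] nonneg
  by (auto simp: indicator_def)

lemma H_op_upper:
  fixes \<phi> :: "real ^ 'd \<Rightarrow> real"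
  assumes "\<phi> \<in> borel_measurable borel" "0 \<le> t"
    and "t \<le> ball_avg r (\<lambda>z. indicator {z. \<phi> z \<ge> t} z * f z) x"
  shows "t \<le> H_op r f \<phi> x"
  unfolding H_op_alt using assms superlevel_avg_le[OF assms(1)]
  by (intro cSup_upper) (auto intro!: bdd_aboveI[where M = "ball_avg r f x"] intro: order_trans)

lemma zero_le_superlevel_avg:
  fixes \<phi> :: "real ^ 'd \<Rightarrow> real"
  shows "0 \<le> ball_avg r (\<lambda>z. indicator {z. \<phi> z \<ge> t} z * f z) x"
  using nonneg by (intro ball_avg_nonneg r) auto

lemma H_op_nonneg:
  fixes \<phi> :: "real ^ 'd \<Rightarrow> real"
  assumes "\<phi> \<in> borel_measurable borel"
  shows "0 \<le> H_op r f \<phi> x"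
  using assms by (intro H_op_upper zero_le_superlevel_avg) auto

lemma H_op_least:
  fixes \<phi> :: "real ^ 'd \<Rightarrow> real"
  assumes "\<And>t. 0 \<le> t \<Longrightarrow> t \<le> ball_avg r (\<lambda>z. indicator {z. \<phi> z \<ge> t} z * f z) x \<Longrightarrow> t \<le> b"
  shows "H_op r f \<phi> x \<le> b"
  unfolding H_op_alt using assms zero_le_superlevel_avg[where t = 0]
  by (intro cSup_least) auto

lemma H_op_le_ball_avg:
  fixes \<phi> :: "real ^ 'd \<Rightarrow> real"
  assumes "\<phi> \<in> borel_measurable borel"
  shows "H_op r f \<phi> x \<le> ball_avg r f x"
  using superlevel_avg_le[OF assms] by (intro H_op_least) (rule order_trans)

text \<open>
  If a level \<open>t\<close> is admissible for \<open>\<phi>\<close> at \<open>h + x\<close>, then \<open>t - \<eta>\<close> is admissible for \<open>\<psi>\<close> at \<open>x\<close>: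
  the translate of the superlevel set \<open>{\<phi> \<ge> t}\<close> lies in \<open>{\<psi> \<ge> t - \<eta>}\<close>, and replacing
  \<open>f (h + z)\<close> by \<open>f z\<close> costs at most \<open>\<eta>\<close> in the average. Lowering the threshold by the same
  \<open>\<eta>\<close> that the average loses is what keeps the constant from growing under iteration. The case
  \<open>\<phi> = \<psi>\<close> transfers moduli of continuity, the case \<open>h = 0\<close>, \<open>\<eta> = 0\<close> is monotonicity.
\<close>
lemma H_op_shift_le:
  fixes \<phi> \<psi> :: "real ^ 'd \<Rightarrow> real"
  assumes meas: "\<phi> \<in> borel_measurable borel" "\<psi> \<in> borel_measurable borel"
    and "\<eta> \<ge> 0"
    and f_le: "\<And>z. f (h + z) \<le> f z + \<eta>"
    and le: "\<And>z. \<phi> (h + z) \<le> \<psi> z + \<eta>"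
  shows "H_op r f \<phi> (h + x) \<le> H_op r f \<psi> x + \<eta>"
proof (rule H_op_least)
  fix t
  assume t: "0 \<le> t" "t \<le> ball_avg r (\<lambda>z. indicator {z. \<phi> z \<ge> t} z * f z) (h + x)"
  show "t \<le> H_op r f \<psi> x + \<eta>"
    \<comment> \<open>Only non-negative levels are admissible, so \<open>t - \<eta>\<close> can serve only if \<open>t \<ge> \<eta>\<close>.\<close>
  proof (cases "t \<le> \<eta>")
    case True
    then show ?thesis using H_op_nonneg[OF meas(2), of x] by simp
  next
    case False
    have "indicator {z. \<phi> z \<ge> t} (h + z) * f (h + z) \<le> indicator {z. \<psi> z \<ge> t - \<eta>} z * f z + \<eta>" for z
      using f_le[of z] le[of z] nonneg[of z] \<open>\<eta> \<ge> 0\<close> by (auto simp: indicator_def)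
    note ball_avg_shift_le[OF integrable_superlevel[OF meas(1)] integrable_superlevel[OF meas(2)] r this, of x]
    with t(2) have "t - \<eta> \<le> ball_avg r (\<lambda>z. indicator {z. \<psi> z \<ge> t - \<eta>} z * f z) x"
      by simp
    with False have "t - \<eta> \<le> H_op r f \<psi> x"
      by (intro H_op_upper meas) auto
    then show ?thesis by simp
  qed
qed

lemma H_op_mono:
  fixes \<phi> \<psi> :: "real ^ 'd \<Rightarrow> real"
  assumes "\<phi> \<in> borel_measurable borel" "\<psi> \<in> borel_measurable borel" "\<And>z. \<phi> z \<le> \<psi> z"
  shows "H_op r f \<phi> x \<le> H_op r f \<psi> x"
  using H_op_shift_le[OF assms(1,2), of 0 0 x] assms(3) by simp

lemma inherits_shift_bounds_ball_avg: "inherits_shift_bounds f (ball_avg r f)"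
  unfolding inherits_shift_bounds_def by (blast intro: ball_avg_shift_le f r)

lemma inherits_shift_bounds_H_op:
  assumes "\<phi> \<in> borel_measurable borel" "inherits_shift_bounds f \<phi>"
  shows "inherits_shift_bounds f (H_op r f \<phi>)"
  using assms(2) H_op_shift_le[OF assms(1,1)] unfolding inherits_shift_bounds_def by blast

end

section \<open>Uniform convergence\<close>

text \<open>
  The radius \<open>d\<close> depends on \<open>f\<close> and \<open>e\<close> alone: it is one that works for \<open>f\<close>.
\<close>
lemma uniformly_equicontinuous_if_inherits_shift_bounds:
  fixes f :: "'a::real_normed_vector \<Rightarrow> real"
  assumes "uniformly_continuous_on UNIV f" and "e > 0"
  obtains d where "d > 0"
    and "\<And>\<phi> x y. inherits_shift_bounds f \<phi> \<Longrightarrow> dist x y < d \<Longrightarrow> dist (\<phi> x) (\<phi> y) \<le> e"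
proof -
  obtain d where "d > 0" and d: "\<And>x y. dist x y < d \<Longrightarrow> dist (f x) (f y) < e"
    using assms unfolding uniformly_continuous_on_def by (metis UNIV_I)
  have one_sided: "\<phi> x \<le> \<phi> y + e" if \<phi>: "inherits_shift_bounds f \<phi>" and xy: "dist x y < d" for \<phi> x y
  proof -
    have "f (x - y + z) \<le> f z + e" for z
      using d[of "x - y + z" z] xy by (simp add: dist_norm)
    then have "\<phi> (x - y + y) \<le> \<phi> y + e"
      using \<phi> \<open>e > 0\<close> unfolding inherits_shift_bounds_def by (meson less_imp_le)
    then show ?thesis by simp
  qed
  show thesis
  proof (rule that[OF \<open>d > 0\<close>])
    fix \<phi> :: "'a \<Rightarrow> real" and x y :: 'a
    assume "inherits_shift_bounds f \<phi>" "dist x y < d"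
    with one_sided[of \<phi> x y] one_sided[of \<phi> y x] show "dist (\<phi> x) (\<phi> y) \<le> e"
      by (simp add: dist_commute dist_real_def abs_le_iff)
  qed
qed

lemma continuous_if_inherits_shift_bounds:
  fixes f :: "'a::real_normed_vector \<Rightarrow> real"
  assumes "uniformly_continuous_on UNIV f" and "inherits_shift_bounds f \<phi>"
  shows "continuous_on UNIV \<phi>"
proof -
  have "\<exists>d>0. \<forall>y. dist y x < d \<longrightarrow> dist (\<phi> y) (\<phi> x) \<le> e" if "e > 0" for x e
    by (rule uniformly_equicontinuous_if_inherits_shift_bounds[OF assms(1) that])
      (use assms(2) in blast)
  then show ?thesis
    unfolding continuous_on_iff by (meson UNIV_I dense order_le_less_trans)
qed

text \<open>
  Convergence is uniform on a finite net of the compact set, and equicontinuity, which the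
  pointwise limit inherits, extends the estimate from the net to the whole set. Off the compact
  set both the sequence and its limit are small.
\<close>
lemma uniformly_convergent_if_equicontinuous_and_small_off_compact:
  fixes \<phi> :: "nat \<Rightarrow> 'a::metric_space \<Rightarrow> real"
  assumes conv: "\<And>x. (\<lambda>k. \<phi> k x) \<longlonglongrightarrow> l x"
    and equi: "\<And>e. e > 0 \<Longrightarrow> \<exists>d>0. \<forall>k x y. dist x y < d \<longrightarrow> dist (\<phi> k x) (\<phi> k y) \<le> e"
    and small: "\<And>e. e > 0 \<Longrightarrow> \<exists>K. compact K \<and> (\<forall>x k. x \<notin> K \<longrightarrow> \<bar>\<phi> k x\<bar> \<le> e)"
  shows "uniform_limit UNIV \<phi> l sequentially"
proof (rule uniform_limitI)
  fix e :: real
  assume "e > 0"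
  then have e: "e / 4 > 0" by simp
  obtain d where "d > 0" and d: "\<And>k x y. dist x y < d \<Longrightarrow> dist (\<phi> k x) (\<phi> k y) \<le> e / 4"
    using equi[OF e] by blast
  have dl: "dist (l x) (l y) \<le> e / 4" if "dist x y < d" for x y
    using d[OF that] by (intro tendsto_le[OF _ tendsto_const tendsto_dist[OF conv conv]]) auto
  obtain K where "compact K" and K: "\<And>x k. x \<notin> K \<Longrightarrow> \<bar>\<phi> k x\<bar> \<le> e / 4"
    using small[OF e] by blast
  have Kl: "\<bar>l x\<bar> \<le> e / 4" if "x \<notin> K" for x
    using K[OF that] by (intro tendsto_le[OF _ tendsto_const tendsto_rabs[OF conv]]) auto
  obtain F where "finite F" and F: "K \<subseteq> (\<Union>c\<in>F. ball c d)"
    using compactE_image[OF \<open>compact K\<close>, of K "\<lambda>c. ball c d"] \<open>d > 0\<close>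
    by (metis UN_I centre_in_ball open_ball subsetI)
  have "eventually (\<lambda>k. \<forall>c\<in>F. dist (\<phi> k c) (l c) < e / 4) sequentially"
    using \<open>finite F\<close> tendstoD[OF conv e] by (intro eventually_ball_finite) auto
  then show "eventually (\<lambda>k. \<forall>x\<in>UNIV. dist (\<phi> k x) (l x) < e) sequentially"
  proof eventually_elim
    case (elim k)
    show ?case
    proof
      fix x
      show "dist (\<phi> k x) (l x) < e"
      proof (cases "x \<in> K")
        case True
        then obtain c where c: "c \<in> F" "dist c x < d" using F by auto
        with elim have "dist (\<phi> k c) (l c) < e / 4" by blast
        then show ?thesis
          using d[OF c(2), of k] dl[OF c(2)] e unfolding dist_real_def by linarith
      next
        case False
        then show ?thesis
          using K[OF False, of k] Kl[OF False] e unfolding dist_real_def by linarith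
      qed
    qed
  qed
qed

theorem proposition3p2:
  fixes f :: "real ^ 'd \<Rightarrow> real" and r :: real
  assumes "prob_density f"
    and "uniformly_continuous_on UNIV f"
    and "r > 0"
  shows "uniformly_convergent_on UNIV (\<lambda>k. (H_op r f ^^ k) (ball_avg r f))"
proof -
  have f: "integrable lborel f" and nonneg: "\<And>z. 0 \<le> f z"
    using assms(1) by (auto simp: prob_density_def)
  define \<phi> where "\<phi> k = (H_op r f ^^ k) (ball_avg r f)" for k
  have \<phi>_simps: "\<phi> 0 = ball_avg r f" "\<And>k. \<phi> (Suc k) = H_op r f (\<phi> k)"
    by (simp_all add: \<phi>_def)
  have meas_if: "\<psi> \<in> borel_measurable borel" if "inherits_shift_bounds f \<psi>" for \<psi>
    using continuous_if_inherits_shift_bounds[OF assms(2) that]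
    by (rule borel_measurable_continuous_onI)
  have shift: "inherits_shift_bounds f (\<phi> k)" for k
  proof (induction k)
    case 0
    then show ?case
      using inherits_shift_bounds_ball_avg[OF f nonneg \<open>r > 0\<close>] by (simp add: \<phi>_simps)
  next
    case (Suc k)
    then show ?case
      using inherits_shift_bounds_H_op[OF f nonneg \<open>r > 0\<close> meas_if] by (simp add: \<phi>_simps)
  qed
  note meas = meas_if[OF shift]
  have pos: "0 \<le> \<phi> k x" for k x
    using H_op_nonneg[OF f nonneg \<open>r > 0\<close> meas] ball_avg_nonneg[OF \<open>r > 0\<close> nonneg]
    by (cases k) (simp_all add: \<phi>_simps)
  have step: "\<phi> (Suc k) x \<le> \<phi> k x" for k x
  proof (induction k arbitrary: x)
    case 0
    show ?case using H_op_le_ball_avg[OF f nonneg \<open>r > 0\<close> meas[of 0]] by (simp add: \<phi>_simps)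
  next
    case (Suc k)
    show ?case
      using H_op_mono[OF f nonneg \<open>r > 0\<close> meas meas Suc.IH] by (simp only: \<phi>_simps(2))
  qed
  have dec: "decseq (\<lambda>k. \<phi> k x)" for x
    using step by (rule decseq_SucI)
  have le: "\<phi> k x \<le> ball_avg r f x" for k x
    using decseqD[OF dec, of 0 k x] by (simp add: \<phi>_simps)
  have "\<exists>l. (\<lambda>k. \<phi> k x) \<longlonglongrightarrow> l" for x
    using decseq_convergent[OF dec] pos by metis
  then obtain l where l: "\<And>x. (\<lambda>k. \<phi> k x) \<longlonglongrightarrow> l x"
    by metis
  have "uniform_limit UNIV \<phi> l sequentially"
  proof (rule uniformly_convergent_if_equicontinuous_and_small_off_compact[OF l])
    fix e :: real
    assume "e > 0"
    from assms(2) this show "\<exists>d>0. \<forall>k x y. dist x y < d \<longrightarrow> dist (\<phi> k x) (\<phi> k y) \<le> e"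
      by (rule uniformly_equicontinuous_if_inherits_shift_bounds) (use shift in blast)
    obtain R where R: "\<And>x. norm x > R \<Longrightarrow> ball_avg r f x < e"
      using ball_avg_vanishes_at_infinity[OF f nonneg \<open>r > 0\<close> \<open>e > 0\<close>] by metis
    have "\<bar>\<phi> k x\<bar> \<le> e" if "x \<notin> cball 0 R" for k x
      using pos[of k x] le[of k x] R[of x] that by simp
    then show "\<exists>K. compact K \<and> (\<forall>x k. x \<notin> K \<longrightarrow> \<bar>\<phi> k x\<bar> \<le> e)"
      using compact_cball by blast
  qed
  then show ?thesis
    unfolding \<phi>_def by (rule uniformly_convergentI)
qed

end
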